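(* The processor sharing problem is Whittle indexable: for every choice of parameters $(C,q,p)$ with $C>0$, $p\in(0,1)$, $1>q>2p$, in the single-server problem with cost $c(x,\nu)=Cx+(1-\nu)\lambda$, the optimal threshold $x(\lambda)$ is nondecreasing in $\lambda$, so that the set of passive states (states where $\nu=0$ is optimal) increases monotonically from the empty set to the whole state space $\mathcal N$ as $\lambda$ decreases from $+\infty$ to $-\infty$.
   Context: Original problem: $I$ queues with Bernoulli($p$) common arrivals routed to exactly one queue each slot ($\sum_i\nu^i_t=1$), egalitarian processor sharing departures ($\mathrm{Binomial}(x,q_i/x)$ given $x\ge1$ jobs at server $i$, none at $x=0$), holding costs $C_i>0$; objective to minimize long-run average $\sum_i C_i\mathbb{E}[X^i_t]$. Whittle relaxation with Lagrange multiplier $\lambda$ decouples it into single-server problems: queue $X_{t+1}=X_t-D_{t+1}+\nu_t\xi_{t+1}$ on $\mathcal N=\{0,1,\dots\}$, $\nu_t\in\{0,1\}$ (1 active = arrivals admitted, 0 passive), minimize $\limsup_{T}\frac1T\sum_{t<T}\mathbb{E}[CX_t+(1-\nu_t)\lambda]$. Here $\lambda$ acts as a tax for passivity. Whittle indexability means that for each single-server problem the set of optimally passive states increases monotonically from $\emptyset$ to $\mathcal N$ as $\lambda$ decreases from $\infty$ to $-\infty$; the Whittle index of state $x$ is the $\lambda$ at which active and passive are equally preferable at $x$. *)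

theory Defs
  imports "HOL-Probability.Probability" "HOL-Library.Extended_Nat"
begin

text \<open>Single-server problem of the Whittle relaxation of the processor sharing
  problem.  State space: nat.  Action True = active (arrivals admitted),
  False = passive.\<close>

definition ps_departures :: "real \<Rightarrow> nat \<Rightarrow> nat pmf" where
  "ps_departures q x = (if x = 0 then return_pmf 0 else binomial_pmf x (q / real x))"

definition ps_step :: "real \<Rightarrow> real \<Rightarrow> nat \<Rightarrow> bool \<Rightarrow> nat pmf" where
  "ps_step q p x a =
     bind_pmf (ps_departures q x) (\<lambda>d.
     bind_pmf (bernoulli_pmf p) (\<lambda>xi.
     return_pmf (x - d + (if a \<and> xi then 1 else 0))))"

text \<open>General (Markov, randomized) policies: pol t x = probability of choosing
  the active action at time t in state x.  By the Derman--Strauch theorem these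
  achieve the same state-action marginals as history-dependent policies.\<close>
definition valid_policy :: "(nat \<Rightarrow> nat \<Rightarrow> real) \<Rightarrow> bool" where
  "valid_policy pol \<longleftrightarrow> (\<forall>t x. 0 \<le> pol t x \<and> pol t x \<le> 1)"

fun ps_dist :: "real \<Rightarrow> real \<Rightarrow> (nat \<Rightarrow> nat \<Rightarrow> real) \<Rightarrow> nat \<Rightarrow> nat \<Rightarrow> nat pmf" where
  "ps_dist q p pol x0 0 = return_pmf x0"
| "ps_dist q p pol x0 (Suc t) =
     bind_pmf (ps_dist q p pol x0 t) (\<lambda>x.
       bind_pmf (bernoulli_pmf (pol t x)) (\<lambda>a. ps_step q p x a))"

definition ps_exp_cost ::
  "real \<Rightarrow> real \<Rightarrow> real \<Rightarrow> real \<Rightarrow> (nat \<Rightarrow> nat \<Rightarrow> real) \<Rightarrow> nat \<Rightarrow> nat \<Rightarrow> real" where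
  "ps_exp_cost C q p lam pol x0 t =
     measure_pmf.expectation (ps_dist q p pol x0 t)
       (\<lambda>x. C * real x + (1 - pol t x) * lam)"

definition ps_avg_cost ::
  "real \<Rightarrow> real \<Rightarrow> real \<Rightarrow> real \<Rightarrow> (nat \<Rightarrow> nat \<Rightarrow> real) \<Rightarrow> nat \<Rightarrow> ereal" where
  "ps_avg_cost C q p lam pol x0 =
     limsup (\<lambda>T. ereal ((\<Sum>t<T. ps_exp_cost C q p lam pol x0 t) / real T))"

definition stat_policy :: "(nat \<Rightarrow> bool) \<Rightarrow> nat \<Rightarrow> nat \<Rightarrow> real" where
  "stat_policy \<sigma> = (\<lambda>t x. if \<sigma> x then 1 else 0)"

definition ps_optimal :: "real \<Rightarrow> real \<Rightarrow> real \<Rightarrow> real \<Rightarrow> (nat \<Rightarrow> bool) \<Rightarrow> bool" where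
  "ps_optimal C q p lam \<sigma> \<longleftrightarrow>
     (\<forall>x0 pol. valid_policy pol \<longrightarrow>
        ps_avg_cost C q p lam (stat_policy \<sigma>) x0 \<le> ps_avg_cost C q p lam pol x0)"

definition passive_set :: "real \<Rightarrow> real \<Rightarrow> real \<Rightarrow> real \<Rightarrow> nat set" where
  "passive_set C q p lam = {x. \<exists>\<sigma>. ps_optimal C q p lam \<sigma> \<and> \<not> \<sigma> x}"

end

(* Since at most one job arrives per slot, the average cost of a stationary policy depends only on its
   first passive state m, so it equals that of the threshold policy m, and the set of passive states
   is automatically upward closed. For q > 2p the function 2^x is a geometric Lyapunov function under
   every policy; hence the kernel killed at 0 is a contraction and the average cost optimality equation
   has a solution, which yields an optimal stationary policy for every tax. The cost of threshold m is
   C L(m) + lam R(m), where R(m) is the long-run passive fraction, and R is nonincreasing in m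
   (by balance of arrivals and departures and a stochastic monotonicity argument). Lowering lam
   therefore favours thresholds below an optimal one over larger ones. *)
theory Submission
  imports Defs
begin

section \<open>Finite and binomial expectations\<close>

text \<open>Monotonicity in the tax is an exchange argument: a threshold \<open>m\<close> optimal
  for the higher tax meets an arbitrary policy optimal for the lower one. Hence the passive fraction
  of \<open>m\<close> is compared with that of every policy active below \<open>m\<close>, not only
  with other thresholds, and existence of an optimal policy is essential. The balance equation turns
  this into a comparison of busy fractions, that is, of averages of a monotone function. The
  obstacle is the switch at \<open>m\<close>. For \<open>m = 1\<close> the empty queue moves to 1
  with probability \<open>p\<close>, while a single unreplaced job stays only with probability
  \<open>1 - q\<close>, which may be smaller; the kernel is then not stochastically monotone. In
  that case a passive state is a busy one, and balance alone decides. The passive set becomes empty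
  in the limit because every threshold has a strictly positive passive fraction, so a large tax
  makes it dearer than never being passive.\<close>

lemma expectation_bind_pmf_finite:
  fixes f :: "'b \<Rightarrow> real"
  assumes "finite (set_pmf M)" "\<And>x. x \<in> set_pmf M \<Longrightarrow> finite (set_pmf (N x))"
  shows "measure_pmf.expectation (bind_pmf M N) f =
         measure_pmf.expectation M (\<lambda>x. measure_pmf.expectation (N x) f)"
  using assms
  by (subst pmf_expectation_bind[of "set_pmf M"]) (auto simp: integral_measure_pmf[of "set_pmf M"])

lemma expectation_mono_pmf_finite:
  fixes f g :: "'b \<Rightarrow> real"
  assumes "finite (set_pmf M)" "\<And>x. x \<in> set_pmf M \<Longrightarrow> f x \<le> g x"
  shows "measure_pmf.expectation M f \<le> measure_pmf.expectation M g"
  using assms by (intro integral_mono_AE integrable_measure_pmf_finite) (auto simp: AE_measure_pmf_iff)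

lemma binomial_expectation_Suc:
  fixes f :: "nat \<Rightarrow> real"
  assumes r: "r \<in> {0..1}"
  shows "measure_pmf.expectation (binomial_pmf (Suc n) r) f =
         r * measure_pmf.expectation (binomial_pmf n r) (\<lambda>k. f (Suc k)) +
         (1 - r) * measure_pmf.expectation (binomial_pmf n r) f"
proof -
  have fin: "finite (set_pmf (bernoulli_pmf r))" by (rule finite)
  show ?thesis
    unfolding binomial_pmf_Suc[OF r]
    using r fin
    by (subst expectation_bind_pmf_finite)
       (auto simp: expectation_bind_pmf_finite finite_set_pmf_binomial_pmf)
qed

text \<open>Condition on the first trial: a larger success probability raises both conditional
  expectations by induction, and it shifts weight to the larger one, that of
  \<open>f (Suc k)\<close>.\<close>

lemma binomial_expectation_mono_prob:
  fixes f :: "nat \<Rightarrow> real"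
  assumes "0 \<le> r" "r \<le> s" "s \<le> 1" "mono f"
  shows "measure_pmf.expectation (binomial_pmf n r) f \<le> measure_pmf.expectation (binomial_pmf n s) f"
  using assms(4)
proof (induction n arbitrary: f)
  case 0
  then show ?case using assms(1-3) by (simp add: binomial_pmf_0)
next
  case (Suc n)
  let ?E = "\<lambda>r f. measure_pmf.expectation (binomial_pmf n r) f"
  have m: "mono (\<lambda>k. f (Suc k))" using Suc.prems by (auto simp: mono_def)
  have a: "?E r f \<le> ?E s f" by (rule Suc.IH[OF Suc.prems])
  have b: "?E r (\<lambda>k. f (Suc k)) \<le> ?E s (\<lambda>k. f (Suc k))" by (rule Suc.IH[OF m])
  have c: "?E s f \<le> ?E s (\<lambda>k. f (Suc k))"
    using assms Suc.prems
    by (intro expectation_mono_pmf_finite finite_set_pmf_binomial_pmf) (auto simp: mono_def)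
  have "r * ?E r (\<lambda>k. f (Suc k)) + (1 - r) * ?E r f
      \<le> r * ?E s (\<lambda>k. f (Suc k)) + (1 - r) * ?E s f"
    using a b assms by (intro add_mono mult_left_mono) auto
  also have "\<dots> = ?E s f + r * (?E s (\<lambda>k. f (Suc k)) - ?E s f)" by (simp add: algebra_simps)
  also have "\<dots> \<le> ?E s f + s * (?E s (\<lambda>k. f (Suc k)) - ?E s f)"
    using c assms by (intro add_left_mono mult_right_mono) auto
  also have "\<dots> = s * ?E s (\<lambda>k. f (Suc k)) + (1 - s) * ?E s f" by (simp add: algebra_simps)
  finally show ?case using assms by (simp add: binomial_expectation_Suc)
qed

text \<open>Generating function, evaluated later at \<open>z = 1/2\<close> for the Lyapunov bound
  and at \<open>z = 0\<close>, where \<open>0 ^ 0 = 1\<close> isolates the event of no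
  departure.\<close>

lemma binomial_expectation_power:
  assumes r: "r \<in> {0..1}"
  shows "measure_pmf.expectation (binomial_pmf n r) (\<lambda>k. z ^ k) = (1 - r + r * z :: real) ^ n"
  by (induction n) (use r in \<open>simp_all add: binomial_pmf_0 binomial_expectation_Suc algebra_simps\<close>)

lemma binomial_expectation_id:
  assumes r: "r \<in> {0..1}"
  shows "measure_pmf.expectation (binomial_pmf n r) real = real n * r"
proof (induction n)
  case (Suc n)
  have "measure_pmf.expectation (binomial_pmf n r) (\<lambda>k. real (Suc k)) =
      1 + measure_pmf.expectation (binomial_pmf n r) real"
    using r by simp
  then show ?case using Suc r by (simp add: binomial_expectation_Suc algebra_simps)
qed (use r in \<open>simp add: binomial_pmf_0\<close>)

section \<open>Minima over finite action sets, and Cesaro limits\<close>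

lemma Min_image_attained:
  fixes F :: "'a \<Rightarrow> 'b :: linorder"
  assumes "finite A" "A \<noteq> {}"
  obtains a where "a \<in> A" "Min (F ` A) = F a"
proof -
  have "Min (F ` A) \<in> F ` A" using assms by (intro Min_in) auto
  then obtain a where "Min (F ` A) = F a" "a \<in> A" by (rule imageE)
  then show thesis using that by metis
qed

text \<open>Makes Bellman minima nonexpansive: an action minimising \<open>G\<close> is a candidate
  for \<open>F\<close>.\<close>

lemma Min_image_le_plus:
  fixes F G :: "'a \<Rightarrow> real"
  assumes "finite A" "A \<noteq> {}" "\<And>a. a \<in> A \<Longrightarrow> F a \<le> G a + b"
  shows "Min (F ` A) \<le> Min (G ` A) + b"
proof -
  obtain a where a: "a \<in> A" "Min (G ` A) = G a"
    using Min_image_attained[OF assms(1,2), of G] .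
  have "Min (F ` A) \<le> F a" using assms(1) a by auto
  then show ?thesis using assms(3)[OF a(1)] a(2) by simp
qed

lemma Min_image_add_const:
  fixes F :: "'a \<Rightarrow> real"
  assumes "finite A" "A \<noteq> {}"
  shows "Min ((\<lambda>a. F a + b) ` A) = Min (F ` A) + b"
  using Min_image_le_plus[OF assms, of "\<lambda>a. F a + b" F b]
    Min_image_le_plus[OF assms, of F "\<lambda>a. F a + b" "- b"] by simp

text \<open>Telescoped Poisson equations leave cumulative sums that differ from \<open>g * T\<close>
  by boundary terms bounded in \<open>T\<close>.\<close>

lemma bounded_deviation_average_tendsto:
  fixes s :: "nat \<Rightarrow> real"
  assumes "\<And>T. \<bar>s T - g * real T\<bar> \<le> D"
  shows "(\<lambda>T. s T / real T) \<longlonglongrightarrow> g"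
proof -
  have "(\<lambda>T. s T / real T - g) \<longlonglongrightarrow> 0"
  proof (rule Lim_null_comparison)
    show "\<forall>\<^sub>F T in sequentially. norm (s T / real T - g) \<le> D / real T"
    proof (rule eventually_mono[OF eventually_gt_at_top[of 0]])
      fix T :: nat assume T: "0 < T"
      then have "s T / real T - g = (s T - g * real T) / real T" by (simp add: field_simps)
      then show "norm (s T / real T - g) \<le> D / real T"
        using assms[of T] T by (simp add: divide_right_mono)
    qed
    show "(\<lambda>T. D / real T) \<longlonglongrightarrow> 0" by (rule lim_const_over_n)
  qed
  then show ?thesis by (simp add: LIM_zero_iff)
qed

lemma valid_stat_policy [simp]: "valid_policy (stat_policy \<sigma>)"
  by (simp add: valid_policy_def stat_policy_def)

section \<open>The one-step kernel\<close>

locale processor_sharing =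
  fixes q p :: real
  assumes p_pos: "0 < p" and q_gt: "2 * p < q" and q_lt: "q < 1"
begin

lemma p_half: "p < 1/2" and q_pos: "0 < q" and p_lt_q: "p < q"
  using p_pos q_gt q_lt by auto

lemma prob_in: "q / real x \<in> {0..1}" if "x > 0"
  using that q_pos q_lt by (auto simp: field_simps)

text \<open>Departures only. Arrivals come after them, so a full step is \<open>surv\<close> of an
  averaged function, and the binomial estimates are made for \<open>surv\<close> alone.\<close>

definition surv :: "nat \<Rightarrow> (nat \<Rightarrow> real) \<Rightarrow> real" where
  "surv x f = measure_pmf.expectation (ps_departures q x) (\<lambda>d. f (x - d))"

definition nxt :: "nat \<Rightarrow> bool \<Rightarrow> (nat \<Rightarrow> real) \<Rightarrow> real" where
  "nxt x a f = measure_pmf.expectation (ps_step q p x a) f"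

lemma set_departures: "set_pmf (ps_departures q x) \<subseteq> {..x}"
  using prob_in[of x] q_pos by (auto simp: ps_departures_def set_pmf_binomial_eq split: if_splits)

lemma departures_le: "d \<in> set_pmf (ps_departures q x) \<Longrightarrow> d \<le> x"
  using set_departures by blast

lemma finite_departures [simp]: "finite (set_pmf (ps_departures q x))"
  using set_departures finite_subset by blast

lemma set_step: "set_pmf (ps_step q p x a) \<subseteq> {..x + (if a then 1 else 0)}"
  using set_departures[of x] by (auto simp: ps_step_def split: if_splits)

lemma finite_step [simp]: "finite (set_pmf (ps_step q p x a))"
  using set_step finite_subset by blast

lemma nxt_conv_surv:
  "nxt x a f = surv x (\<lambda>y. if a then (1 - p) * f y + p * f (Suc y) else f y)"
proof -
  have fin: "finite (set_pmf (bernoulli_pmf p))" by (rule finite)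
  show ?thesis
    unfolding nxt_def surv_def ps_step_def using p_pos p_half fin
    by (subst expectation_bind_pmf_finite)
       (auto simp: expectation_bind_pmf_finite algebra_simps)
qed

lemma surv_0 [simp]: "surv 0 f = f 0"
  by (simp add: surv_def ps_departures_def)

lemma surv_pos: "x > 0 \<Longrightarrow> surv x f = measure_pmf.expectation (binomial_pmf x (q / real x)) (\<lambda>d. f (x - d))"
  by (simp add: surv_def ps_departures_def)

lemma surv_integrable [simp]: "integrable (measure_pmf (ps_departures q x)) (f :: nat \<Rightarrow> real)"
  by (rule integrable_measure_pmf_finite) simp

lemma step_integrable [simp]: "integrable (measure_pmf (ps_step q p x a)) (f :: nat \<Rightarrow> real)"
  by (rule integrable_measure_pmf_finite) simp

lemma surv_mono: "(\<And>y. y \<le> x \<Longrightarrow> f y \<le> g y) \<Longrightarrow> surv x f \<le> surv x g"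
  unfolding surv_def by (rule expectation_mono_pmf_finite) auto

lemma nxt_mono: "(\<And>y. f y \<le> g y) \<Longrightarrow> nxt x a f \<le> nxt x a g"
  unfolding nxt_def by (rule expectation_mono_pmf_finite) auto

lemma nxt_diff: "nxt x a (\<lambda>y. f y - g y) = nxt x a f - nxt x a g"
  unfolding nxt_def by simp

lemma nxt_cmult: "nxt x a (\<lambda>y. c * f y) = c * nxt x a f"
  unfolding nxt_def by simp

lemma nxt_const [simp]: "nxt x a (\<lambda>y. c) = c"
  unfolding nxt_def by simp

lemma surv_id: "surv x real = real x - (if x = 0 then 0 else q)"
proof (cases "x = 0")
  case False
  have "surv x real = measure_pmf.expectation (ps_departures q x) (\<lambda>d. real x - real d)"
    unfolding surv_def
    by (rule integral_cong_AE) (auto simp: AE_measure_pmf_iff of_nat_diff departures_le)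
  also have "\<dots> = real x - q"
    using False prob_in[of x] binomial_expectation_id[of "q / real x" x]
    by (simp add: ps_departures_def)
  finally show ?thesis using False by simp
qed simp

lemma nxt_id: "nxt x a real = real x - (if x = 0 then 0 else q) + (if a then p else 0)"
proof -
  have "(\<lambda>y. (1 - p) * real y + p * real (Suc y)) = (\<lambda>y. real y + p)"
    by (auto simp: algebra_simps)
  moreover have "surv x (\<lambda>y. real y + p) = surv x real + p"
    unfolding surv_def by simp
  ultimately show ?thesis by (simp add: nxt_conv_surv surv_id)
qed

text \<open>The hypothesis \<open>q > 2 p\<close> enters here: it makes \<open>2 ^ x\<close> a geometric Lyapunov function
  with factor \<open>exp (p - q / 2) < 1\<close> off the empty state.\<close>

definition rate :: real where "rate = max (exp (p - q / 2)) (2 * p)"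

lemma rate_bounds: "0 < rate" "rate < 1"
  using p_pos p_half q_gt by (auto simp: rate_def less_max_iff_disj)

text \<open>Each of the \<open>x\<close> jobs contributes a factor \<open>1 - q / (2 * x)\<close> to
  the expectation of \<open>(1/2) ^ d\<close>; the product is at most \<open>exp (- q / 2)\<close>,
  uniformly in \<open>x\<close>.\<close>

lemma surv_power2: "surv x (\<lambda>y. 2 ^ y) \<le> (if x = 0 then 1 else exp (- q / 2) * 2 ^ x)"
proof (cases "x = 0")
  case False
  have "surv x (\<lambda>y. 2 ^ y) = measure_pmf.expectation (ps_departures q x) (\<lambda>d. 2 ^ x * (1/2) ^ d)"
    unfolding surv_def
    by (auto simp: AE_measure_pmf_iff power_diff departures_le power_one_over field_simps
        intro!: integral_cong_AE)
  also have "\<dots> = 2 ^ x * (1 - q / real x + q / real x * (1/2)) ^ x"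
    using False prob_in[of x] binomial_expectation_power[of "q / real x" x "1/2"]
    by (simp add: ps_departures_def)
  also have "\<dots> \<le> 2 ^ x * (exp (- (q / (2 * real x)))) ^ x"
  proof (intro mult_left_mono power_mono)
    show "1 - q / real x + q / real x * (1/2) \<le> exp (- (q / (2 * real x)))"
      using exp_ge_add_one_self[of "- (q / (2 * real x))"] by (simp add: field_simps)
    show "0 \<le> 1 - q / real x + q / real x * (1/2)" using prob_in[of x] False q_pos by simp
  qed auto
  also have "(exp (- (q / (2 * real x)))) ^ x = exp (- q / 2)"
    using False by (simp flip: exp_of_nat_mult)
  finally show ?thesis using False by (simp add: mult.commute)
qed simp

lemma nxt_power2_le: "nxt x a (\<lambda>y. 2 ^ y) \<le> (1 + p) * (if x = 0 then 1 else exp (- q / 2) * 2 ^ x)"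
proof -
  have "nxt x a (\<lambda>y. 2 ^ y) \<le> surv x (\<lambda>y. (1 + p) * 2 ^ y)"
    unfolding nxt_conv_surv using p_pos by (intro surv_mono) (auto simp: algebra_simps)
  also have "\<dots> = (1 + p) * surv x (\<lambda>y. 2 ^ y)"
    unfolding surv_def by simp
  also have "\<dots> \<le> (1 + p) * (if x = 0 then 1 else exp (- q / 2) * 2 ^ x)"
    using surv_power2[of x] p_pos by (intro mult_left_mono) auto
  finally show ?thesis .
qed

lemma nxt_power2_pos: "x > 0 \<Longrightarrow> nxt x a (\<lambda>y. 2 ^ y) \<le> rate * 2 ^ x"
proof -
  assume "x > 0"
  then have "nxt x a (\<lambda>y. 2 ^ y) \<le> (1 + p) * (exp (- q / 2) * 2 ^ x)"
    using nxt_power2_le[of x a] by simp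
  also have "\<dots> \<le> exp p * (exp (- q / 2) * 2 ^ x)"
    by (intro mult_right_mono) auto
  also have "\<dots> = exp (p - q / 2) * 2 ^ x" by (simp flip: exp_add)
  also have "\<dots> \<le> rate * 2 ^ x" by (intro mult_right_mono) (auto simp: rate_def)
  finally show ?thesis .
qed

text \<open>The additive 2 pays for the empty state, where the expectation is at most
  \<open>1 + p\<close>.\<close>

lemma nxt_power2_drift: "nxt x a (\<lambda>y. 2 ^ y) \<le> rate * 2 ^ x + 2"
  using nxt_power2_pos[of x a] nxt_power2_le[of x a] p_half rate_bounds by (cases "x = 0") auto

text \<open>From the empty state only an arrival survives the killing, with weight
  \<open>2 * p\<close>; this explains the second term of the maximum in \<open>rate\<close>.\<close>

lemma nxt_killed_power2: "nxt x a ((\<lambda>y. 2 ^ y)(0 := 0)) \<le> rate * 2 ^ x"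
proof (cases "x = 0")
  case True
  then have "nxt x a ((\<lambda>y. 2 ^ y)(0 := 0)) \<le> 2 * p"
    using p_pos by (simp add: nxt_conv_surv)
  then show ?thesis using True by (auto simp: rate_def)
next
  case False
  have "nxt x a ((\<lambda>y. 2 ^ y)(0 := 0)) \<le> nxt x a (\<lambda>y. 2 ^ y)"
    by (rule nxt_mono) auto
  then show ?thesis using nxt_power2_pos[of x a] False by simp
qed

section \<open>The average cost equation\<close>

text \<open>Taboo kernel: paths are stopped on entering the empty state.\<close>

definition killed :: "nat \<Rightarrow> bool \<Rightarrow> (nat \<Rightarrow> real) \<Rightarrow> real" where
  "killed x a f = nxt x a (f(0 := 0))"

lemma killed_diff: "killed x a (\<lambda>y. f y - g y) = killed x a f - killed x a g"
proof -
  have "(\<lambda>y. f y - g y)(0 := 0) = (\<lambda>y. (f(0 := 0)) y - (g(0 := 0)) y)" by auto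
  then show ?thesis unfolding killed_def by (simp only: nxt_diff)
qed

lemma killed_0 [simp]: "killed x a (\<lambda>y. 0) = 0"
  by (simp add: killed_def fun_upd_idem)

lemma killed_mono: "(\<And>y. f y \<le> g y) \<Longrightarrow> killed x a f \<le> killed x a g"
  unfolding killed_def by (rule nxt_mono) auto

lemma killed_le:
  assumes "\<And>y. f y \<le> B * 2 ^ y" "0 \<le> B"
  shows "killed x a f \<le> rate * B * 2 ^ x"
proof -
  have "killed x a f \<le> nxt x a (\<lambda>y. B * ((\<lambda>y. 2 ^ y)(0 := 0)) y)"
    unfolding killed_def using assms by (intro nxt_mono) auto
  also have "\<dots> = B * nxt x a ((\<lambda>y. 2 ^ y)(0 := 0))" by (rule nxt_cmult)
  also have "\<dots> \<le> B * (rate * 2 ^ x)" using assms(2) nxt_killed_power2 by (intro mult_left_mono)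
  finally show ?thesis by (simp add: mult_ac)
qed

lemma killed_abs_le:
  assumes "\<And>y. \<bar>f y\<bar> \<le> B * 2 ^ y"
  shows "\<bar>killed x a f\<bar> \<le> rate * B * 2 ^ x"
proof -
  have B: "0 \<le> B" using assms[of 0] by simp
  have 1: "killed x a f \<le> rate * B * 2 ^ x"
    using assms B by (intro killed_le) (auto simp: abs_le_iff)
  have "killed x a (\<lambda>y. 0 - f y) \<le> rate * B * 2 ^ x"
    using assms B by (intro killed_le) (auto simp: abs_le_iff)
  then have "- killed x a f \<le> rate * B * 2 ^ x"
    unfolding killed_diff by simp
  with 1 show ?thesis by (simp add: abs_le_iff)
qed

text \<open>A maximum principle by iteration: a bound \<open>e * 2 ^ x\<close> improves to
  \<open>(b + rate * e) * 2 ^ x\<close>, whose fixed point is \<open>b / (1 - rate)\<close>. The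
  action may vary with \<open>x\<close> because \<open>killed_le\<close> is uniform in it. For
  \<open>b = 0\<close> the conclusion is \<open>z x \<le> 0\<close>.\<close>

lemma killed_subsolution_le:
  assumes K: "\<And>x. z x \<le> K * 2 ^ x" and b: "0 \<le> b"
    and sub: "\<And>x. \<exists>a. z x \<le> b + killed x a z"
  shows "z x \<le> b / (1 - rate) * 2 ^ x"
proof -
  define K' where "K' = max K 0"
  define e where "e n = rate ^ n * K' + b / (1 - rate)" for n
  have e0: "0 \<le> e n" for n using rate_bounds b by (simp add: e_def K'_def)
  have it: "z x \<le> e n * 2 ^ x" for n x
  proof (induction n arbitrary: x)
    case 0
    have "z x \<le> K' * 2 ^ x"
      using K[of x] by (rule order_trans) (auto simp: K'_def intro!: mult_right_mono)
    also have "\<dots> \<le> e 0 * 2 ^ x"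
      using rate_bounds b by (intro mult_right_mono) (auto simp: e_def)
    finally show ?case .
  next
    case (Suc n)
    obtain a where "z x \<le> b + killed x a z" using sub by blast
    also have "\<dots> \<le> b * 2 ^ x + rate * e n * 2 ^ x"
      using killed_le[of z "e n" x a, OF Suc.IH e0] b mult_left_mono[of 1 "2 ^ x" b] by simp
    also have "\<dots> = (b + rate * e n) * 2 ^ x" by (simp add: algebra_simps)
    also have "b + rate * e n = e (Suc n)"
      using rate_bounds by (simp add: e_def field_simps)
    finally show ?case .
  qed
  have "(\<lambda>n. e n * 2 ^ x) \<longlonglongrightarrow> (0 * K' + b / (1 - rate)) * 2 ^ x"
    unfolding e_def using rate_bounds by (intro tendsto_intros LIMSEQ_power_zero) auto
  then show ?thesis
    using LIMSEQ_le_const[of _ _ "z x"] it by fastforce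
qed

text \<open>Successive approximation from 0 for the Bellman operator, a contraction with factor
  \<open>rate\<close> in the norm weighted by \<open>2 ^ x\<close>. The sets \<open>A x\<close>
  serve two uses: singletons evaluate a fixed policy, \<open>UNIV\<close> optimises.\<close>

lemma killed_fixpoint_exists:
  fixes c :: "nat \<Rightarrow> bool \<Rightarrow> real" and A :: "nat \<Rightarrow> bool set"
  assumes c: "\<And>x a. \<bar>c x a\<bar> \<le> K * 2 ^ x" and A: "\<And>x. A x \<noteq> {}"
  obtains h B where "\<And>x. \<bar>h x\<bar> \<le> B * 2 ^ x"
    "\<And>x. h x = Min ((\<lambda>a. c x a + killed x a h) ` A x)"
proof -
  define T where "T f x = Min ((\<lambda>a. c x a + killed x a f) ` A x)" for f x
  have T_le: "T f x \<le> T g x + rate * B * 2 ^ x" if "\<And>y. \<bar>f y - g y\<bar> \<le> B * 2 ^ y" for f g B x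
    unfolding T_def
  proof (rule Min_image_le_plus)
    fix a
    show "c x a + killed x a f \<le> c x a + killed x a g + rate * B * 2 ^ x"
      using killed_abs_le[of "\<lambda>y. f y - g y" B x a, OF that] by (simp add: killed_diff)
  qed (use A in auto)
  have T_dist: "\<bar>T f x - T g x\<bar> \<le> rate * B * 2 ^ x" if "\<And>y. \<bar>f y - g y\<bar> \<le> B * 2 ^ y" for f g B x
    using T_le[of f g B x] T_le[of g f B x] that by (simp add: abs_le_iff)
  have K: "0 \<le> K" using c[of 0 undefined] by simp
  have T_0: "\<bar>T (\<lambda>_. 0) x\<bar> \<le> K * 2 ^ x" for x
  proof -
    obtain a where "T (\<lambda>_. 0) x = c x a + killed x a (\<lambda>_. 0)"
      using Min_image_attained[of "A x" "\<lambda>a. c x a + killed x a (\<lambda>_. 0)"] A[of x]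
      by (auto simp: T_def)
    then show ?thesis using c[of x a] by simp
  qed
  \<comment> \<open>Solves \<open>L = K + rate * L\<close>, so this bound on the iterates reproduces
    itself.\<close>
  define L where "L = K / (1 - rate)"
  define u where "u n = (T ^^ n) (\<lambda>_. 0)" for n
  have u_Suc: "u (Suc n) = T (u n)" for n by (simp add: u_def)
  have u_bound: "\<bar>u n x\<bar> \<le> L * 2 ^ x" for n x
  proof (induction n arbitrary: x)
    case 0
    show ?case using K rate_bounds by (simp add: u_def L_def)
  next
    case (Suc n)
    have "\<bar>T (u n) x\<bar> \<le> \<bar>T (\<lambda>_. 0) x\<bar> + rate * L * 2 ^ x"
      using T_dist[of "u n" "\<lambda>_. 0" L x] Suc.IH by simp
    also have "\<dots> \<le> (K + rate * L) * 2 ^ x" using T_0[of x] by (simp add: algebra_simps)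
    also have "K + rate * L = L" using rate_bounds by (simp add: L_def field_simps)
    finally show ?case by (simp add: u_Suc)
  qed
  have u_dist: "\<bar>u (n + m) x - u n x\<bar> \<le> rate ^ n * L * 2 ^ x" for n m x
  proof (induction n arbitrary: x)
    case 0
    show ?case using u_bound by (simp add: u_def)
  next
    case (Suc n)
    show ?case using T_dist[of "u (n + m)" "u n", OF Suc.IH] by (simp add: u_Suc mult_ac)
  qed
  have small: "(\<lambda>n. rate ^ n * L * 2 ^ x) \<longlonglongrightarrow> 0" for x
    using tendsto_mult_left_zero[OF LIMSEQ_power_zero[of rate], of "L * 2 ^ x"] rate_bounds
    by (simp add: mult.assoc)
  have "Cauchy (\<lambda>n. u n x)" for x
  proof (rule metric_CauchyI)
    fix e :: real assume "0 < e"
    then obtain M where M: "rate ^ n * L * 2 ^ x < e / 2" if "n \<ge> M" for n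
      using order_tendstoD(2)[OF small, of "e / 2" x] by (auto simp: eventually_sequentially)
    have "\<bar>u n x - u M x\<bar> < e / 2" if "n \<ge> M" for n
      using u_dist[of M "n - M" x] M[of M] that by simp
    then show "\<exists>M. \<forall>m\<ge>M. \<forall>n\<ge>M. dist (u m x) (u n x) < e"
      by (intro exI[of _ M] allI impI) (rule dist_triangle_half_l[of _ "u M x"], auto simp: dist_real_def abs_minus_commute)
  qed
  then have "\<forall>x. \<exists>l. (\<lambda>n. u n x) \<longlonglongrightarrow> l"
    using Cauchy_convergent unfolding convergent_def by blast
  from choice[OF this] obtain h where h: "(\<lambda>n. u n x) \<longlonglongrightarrow> h x" for x by blast
  have h_dist: "\<bar>h y - u n y\<bar> \<le> rate ^ n * L * 2 ^ y" for n y
  proof (rule LIMSEQ_le_const2)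
    show "(\<lambda>m. \<bar>u (n + m) y - u n y\<bar>) \<longlonglongrightarrow> \<bar>h y - u n y\<bar>"
      using LIMSEQ_ignore_initial_segment[OF h, of n y]
      by (intro tendsto_intros) (simp add: add.commute)
  qed (use u_dist in auto)
  show thesis
  proof (rule that)
    show "\<bar>h x\<bar> \<le> L * 2 ^ x" for x using h_dist[of x 0] by (simp add: u_def)
    show "h x = Min ((\<lambda>a. c x a + killed x a h) ` A x)" for x
    proof -
      have "(\<lambda>n. T h x - u (Suc n) x) \<longlonglongrightarrow> 0"
      proof (rule Lim_null_comparison)
        show "\<forall>\<^sub>F n in sequentially. norm (T h x - u (Suc n) x) \<le> rate ^ Suc n * L * 2 ^ x"
          using T_dist[OF h_dist] by (auto simp: u_Suc mult_ac)
        show "(\<lambda>n. rate ^ Suc n * L * 2 ^ x) \<longlonglongrightarrow> 0" by (rule LIMSEQ_Suc[OF small])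
      qed
      moreover have "(\<lambda>n. T h x - u (Suc n) x) \<longlonglongrightarrow> T h x - h x"
        by (intro tendsto_intros LIMSEQ_Suc[OF h])
      ultimately have "0 = T h x - h x" by (rule LIMSEQ_unique)
      then show ?thesis by (simp add: T_def)
    qed
  qed
qed

text \<open>Normalising \<open>h 0 = 0\<close> turns the average cost equation into a fixed point equation for
  the kernel killed at 0, which contracts in the norm weighted by \<open>2 ^ x\<close>; the average cost \<open>g\<close>
  is then the unique root of \<open>g \<mapsto> H g 0\<close>.\<close>

lemma average_cost_equation:
  fixes c :: "nat \<Rightarrow> bool \<Rightarrow> real" and A :: "nat \<Rightarrow> bool set"
  assumes c: "\<And>x a. \<bar>c x a\<bar> \<le> K * 2 ^ x" and A: "\<And>x. A x \<noteq> {}"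
  obtains g h B where "\<And>x. \<bar>h x\<bar> \<le> B * 2 ^ x"
    "\<And>x. g + h x = Min ((\<lambda>a. c x a + nxt x a h) ` A x)"
proof -
  have "\<exists>h. (\<exists>B. \<forall>x. \<bar>h x\<bar> \<le> B * 2 ^ x) \<and>
      (\<forall>x. h x = Min ((\<lambda>a. (c x a - g) + killed x a h) ` A x))" for g
  proof -
    have c_g: "\<bar>c x a - g\<bar> \<le> (K + \<bar>g\<bar>) * 2 ^ x" for x a
    proof -
      have "\<bar>c x a - g\<bar> \<le> K * 2 ^ x + \<bar>g\<bar>" using c[of x a] by linarith
      also have "\<dots> \<le> K * 2 ^ x + \<bar>g\<bar> * 2 ^ x" using mult_left_mono[of 1 "2 ^ x" "\<bar>g\<bar>"] by simp
      finally show ?thesis by (simp add: algebra_simps)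
    qed
    show ?thesis by (rule killed_fixpoint_exists[OF c_g A]) (intro exI conjI allI; assumption)
  qed
  then have "\<forall>g. \<exists>h. (\<exists>B. \<forall>x. \<bar>h x\<bar> \<le> B * 2 ^ x) \<and>
      (\<forall>x. h x = Min ((\<lambda>a. (c x a - g) + killed x a h) ` A x))" by (rule allI)
  from choice[OF this] obtain H where H: "\<forall>g. (\<exists>B. \<forall>x. \<bar>H g x\<bar> \<le> B * 2 ^ x) \<and>
      (\<forall>x. H g x = Min ((\<lambda>a. (c x a - g) + killed x a (H g)) ` A x))" ..
  then have "\<forall>g. \<exists>B. \<forall>x. \<bar>H g x\<bar> \<le> B * 2 ^ x" by (rule all_forward) (erule conjunct1)
  from choice[OF this] obtain B where Hb: "\<bar>H g x\<bar> \<le> B g * 2 ^ x" for g x by blast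
  have Hfix: "H g x = Min ((\<lambda>a. (c x a - g) + killed x a (H g)) ` A x)" for g x
    using H by (elim allE conjE) assumption
  have bnd: "H g' x - H g x \<le> (B g' + B g) * 2 ^ x" for g g' x
    using Hb[of g' x] Hb[of g x] by (simp add: algebra_simps abs_le_iff)
  \<comment> \<open>A minimiser for \<open>g\<close> is a candidate for \<open>g'\<close>, so the
    difference is a subsolution along that one action.\<close>
  have step: "\<exists>a. H g' x - H g x \<le> (g - g') + killed x a (\<lambda>y. H g' y - H g y)" for g g' x
  proof -
    obtain a where a: "a \<in> A x" "H g x = (c x a - g) + killed x a (H g)"
      using Hfix[of g x] Min_image_attained[of "A x" "\<lambda>a. (c x a - g) + killed x a (H g)"] A[of x]
      by auto
    have "H g' x \<le> (c x a - g') + killed x a (H g')"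
      unfolding Hfix[of g' x] using a(1) by (intro Min_le) auto
    with a(2) show ?thesis by (intro exI[of _ a]) (simp add: killed_diff)
  qed
  have mono: "H g' x - H g x \<le> 0" if "g \<le> g'" for g g' x
  proof -
    have "\<exists>a. H g' x - H g x \<le> 0 + killed x a (\<lambda>y. H g' y - H g y)" for x
    proof -
      obtain a where "H g' x - H g x \<le> (g - g') + killed x a (\<lambda>y. H g' y - H g y)"
        using step by blast
      then show ?thesis using that by (intro exI[of _ a]) linarith
    qed
    from killed_subsolution_le[OF bnd _ this] show ?thesis by simp
  qed
  \<comment> \<open>At state 0 the root function falls at least as fast as \<open>g\<close> grows,
    the killed part being nonpositive by \<open>mono\<close>.\<close>
  have slope: "H g' 0 \<le> H g 0 - (g' - g)" if "g \<le> g'" for g g'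
  proof -
    obtain a where "H g' 0 - H g 0 \<le> (g - g') + killed 0 a (\<lambda>y. H g' y - H g y)"
      using step by blast
    moreover have "killed 0 a (\<lambda>y. H g' y - H g y) \<le> 0"
      using killed_mono[of "\<lambda>y. H g' y - H g y" "\<lambda>y. 0" 0 a, OF mono[OF that]] by simp
    ultimately show ?thesis by simp
  qed
  \<comment> \<open>Supplies the continuity for the intermediate value theorem.\<close>
  have lip: "H g' 0 - H g 0 \<le> 1 / (1 - rate) * dist g' g" for g g'
  proof -
    have "\<exists>a. H g' x - H g x \<le> \<bar>g' - g\<bar> + killed x a (\<lambda>y. H g' y - H g y)" for x
    proof -
      obtain a where "H g' x - H g x \<le> (g - g') + killed x a (\<lambda>y. H g' y - H g y)"
        using step by blast
      then show ?thesis by (intro exI[of _ a]) linarith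
    qed
    from killed_subsolution_le[OF bnd _ this, of 0] show ?thesis by (simp add: dist_real_def)
  qed
  have "(1 / (1 - rate))-lipschitz_on UNIV (\<lambda>g. H g 0)"
  proof (rule lipschitz_onI)
    fix g g' :: real
    show "dist (H g 0) (H g' 0) \<le> 1 / (1 - rate) * dist g g'"
      using lip[of g g'] lip[of g' g] by (simp add: dist_real_def abs_le_iff abs_minus_commute)
  qed (use rate_bounds in auto)
  then have cont: "continuous_on UNIV (\<lambda>g. H g 0)" by (rule lipschitz_on_continuous_on)
  \<comment> \<open>A slope of at most -1 forces the sign change into the interval from
    \<open>- b\<close> to \<open>b\<close>.\<close>
  define b where "b = \<bar>H 0 0\<bar>"
  have "H b 0 \<le> 0" "0 \<le> H (- b) 0"
    using slope[of 0 b] slope[of "- b" 0] by (auto simp: b_def)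
  then obtain g where g: "H g 0 = 0"
    using IVT2'[of "\<lambda>g. H g 0" b 0 "- b"] continuous_on_subset[OF cont subset_UNIV]
    by (auto simp: b_def)
  \<comment> \<open>At the root, \<open>H g\<close> already vanishes at 0, so killing changes
    nothing.\<close>
  have ker: "killed x a (H g) = nxt x a (H g)" for x a
    unfolding killed_def using g by (simp add: fun_upd_idem)
  show thesis
  proof (rule that[OF Hb[of g]])
    fix x
    have "H g x = Min ((\<lambda>a. (c x a + nxt x a (H g)) + (- g)) ` A x)"
      using Hfix[of g x] by (simp add: ker algebra_simps)
    also have "\<dots> = Min ((\<lambda>a. c x a + nxt x a (H g)) ` A x) + (- g)"
      using A[of x] by (intro Min_image_add_const) auto
    finally show "g + H g x = Min ((\<lambda>a. c x a + nxt x a (H g)) ` A x)" by simp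
  qed
qed

section \<open>Long-run averages\<close>

definition mean :: "(nat \<Rightarrow> nat \<Rightarrow> real) \<Rightarrow> nat \<Rightarrow> nat \<Rightarrow> (nat \<Rightarrow> real) \<Rightarrow> real" where
  "mean pol x0 t f = measure_pmf.expectation (ps_dist q p pol x0 t) f"

lemma finite_dist [simp]: "finite (set_pmf (ps_dist q p pol x0 t))"
  by (induction t) auto

lemma dist_integrable [simp]: "integrable (measure_pmf (ps_dist q p pol x0 t)) (f :: nat \<Rightarrow> real)"
  by (rule integrable_measure_pmf_finite) simp

lemma mean_0 [simp]: "mean pol x0 0 f = f x0"
  by (simp add: mean_def)

lemma mean_Suc:
  assumes "valid_policy pol"
  shows "mean pol x0 (Suc t) f =
    mean pol x0 t (\<lambda>x. pol t x * nxt x True f + (1 - pol t x) * nxt x False f)"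
  unfolding mean_def nxt_def using assms
  by (simp add: expectation_bind_pmf_finite valid_policy_def mult.commute)

lemma mean_stat_Suc: "mean (stat_policy \<sigma>) x0 (Suc t) f = mean (stat_policy \<sigma>) x0 t (\<lambda>x. nxt x (\<sigma> x) f)"
proof -
  have "(\<lambda>x. stat_policy \<sigma> t x * nxt x True f + (1 - stat_policy \<sigma> t x) * nxt x False f) =
      (\<lambda>x. nxt x (\<sigma> x) f)"
    by (auto simp: stat_policy_def)
  then show ?thesis by (simp only: mean_Suc[OF valid_stat_policy])
qed

lemma mean_mono: "(\<And>y. f y \<le> g y) \<Longrightarrow> mean pol x0 t f \<le> mean pol x0 t g"
  unfolding mean_def by (rule expectation_mono_pmf_finite) auto

lemma mean_add: "mean pol x0 t (\<lambda>y. f y + g y) = mean pol x0 t f + mean pol x0 t g"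
  unfolding mean_def by simp

lemma mean_diff: "mean pol x0 t (\<lambda>y. f y - g y) = mean pol x0 t f - mean pol x0 t g"
  unfolding mean_def by simp

lemma mean_cmult: "mean pol x0 t (\<lambda>y. c * f y) = c * mean pol x0 t f"
  unfolding mean_def by simp

lemma mean_const [simp]: "mean pol x0 t (\<lambda>y. c) = c"
  unfolding mean_def by simp

text \<open>The drift inequality iterates towards its fixed point \<open>2 / (1 - rate)\<close>,
  under every valid policy and uniformly in time. This bounds the boundary terms of all later
  telescoping sums.\<close>

lemma mean_power2_le:
  assumes "valid_policy pol"
  shows "mean pol x0 t (\<lambda>y. 2 ^ y) \<le> 2 ^ x0 + 2 / (1 - rate)"
proof (induction t)
  case (Suc t)
  have v: "0 \<le> pol t x" "pol t x \<le> 1" for x using assms by (auto simp: valid_policy_def)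
  have "mean pol x0 (Suc t) (\<lambda>y. 2 ^ y) \<le> mean pol x0 t (\<lambda>y. rate * 2 ^ y + 2)"
    unfolding mean_Suc[OF assms]
  proof (rule mean_mono)
    fix x
    have "pol t x * nxt x True ((^) 2) + (1 - pol t x) * nxt x False ((^) 2)
        \<le> pol t x * (rate * 2 ^ x + 2) + (1 - pol t x) * (rate * 2 ^ x + 2)"
      using v[of x] nxt_power2_drift by (intro add_mono mult_left_mono) auto
    then show "pol t x * nxt x True ((^) 2) + (1 - pol t x) * nxt x False ((^) 2) \<le> rate * 2 ^ x + 2"
      by (simp add: algebra_simps)
  qed
  also have "\<dots> = rate * mean pol x0 t (\<lambda>y. 2 ^ y) + 2" by (simp add: mean_add mean_cmult)
  also have "\<dots> \<le> rate * (2 ^ x0 + 2 / (1 - rate)) + 2"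
    using Suc rate_bounds by (intro add_right_mono mult_left_mono) auto
  also have "\<dots> = rate * 2 ^ x0 + 2 / (1 - rate)" using rate_bounds by (simp add: field_simps)
  also have "\<dots> \<le> 2 ^ x0 + 2 / (1 - rate)" using rate_bounds by simp
  finally show ?case .
qed (use rate_bounds in simp)

lemma mean_abs_le:
  assumes "valid_policy pol" "\<And>x. \<bar>h x\<bar> \<le> B * 2 ^ x"
  shows "\<bar>mean pol x0 t h\<bar> \<le> B * (2 ^ x0 + 2 / (1 - rate))"
proof -
  have B: "0 \<le> B" using assms(2)[of 0] by simp
  have 1: "h x \<le> B * 2 ^ x" and 2: "(- B) * 2 ^ x \<le> h x" for x
    using assms(2)[of x] by (auto simp: abs_le_iff)
  have "mean pol x0 t h \<le> B * mean pol x0 t (\<lambda>y. 2 ^ y)"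
    using mean_mono[of h "\<lambda>x. B * 2 ^ x", OF 1] by (simp add: mean_cmult)
  moreover have "- B * mean pol x0 t (\<lambda>y. 2 ^ y) \<le> mean pol x0 t h"
    using mean_mono[of "\<lambda>x. (- B) * 2 ^ x" h, OF 2] unfolding mean_cmult by simp
  moreover have "B * mean pol x0 t (\<lambda>y. 2 ^ y) \<le> B * (2 ^ x0 + 2 / (1 - rate))"
    using mean_power2_le[OF assms(1)] B by (intro mult_left_mono)
  ultimately show ?thesis by (simp add: abs_le_iff)
qed

definition cost :: "real \<Rightarrow> real \<Rightarrow> nat \<Rightarrow> bool \<Rightarrow> real" where
  "cost C lam x a = C * real x + (if a then 0 else lam)"

lemma real_le_power2: "real x \<le> 2 ^ x"
  using of_nat_less_two_power[of x, where ?'a = real] by simp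

lemma cost_abs_le: "\<bar>cost C lam x a\<bar> \<le> (\<bar>C\<bar> + \<bar>lam\<bar>) * 2 ^ x"
proof -
  have "\<bar>cost C lam x a\<bar> \<le> \<bar>C\<bar> * real x + \<bar>lam\<bar> * 1"
    by (auto simp: cost_def abs_mult intro!: order_trans[OF abs_triangle_ineq])
  also have "\<dots> \<le> \<bar>C\<bar> * 2 ^ x + \<bar>lam\<bar> * 2 ^ x"
    using real_le_power2[of x] by (intro add_mono mult_left_mono) auto
  finally show ?thesis by (simp add: algebra_simps)
qed

lemma ps_exp_cost_eq:
  "ps_exp_cost C q p lam pol x0 t =
    mean pol x0 t (\<lambda>x. pol t x * cost C lam x True + (1 - pol t x) * cost C lam x False)"
  unfolding ps_exp_cost_def mean_def by (simp add: cost_def algebra_simps)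

text \<open>Verification: mixing the inequality over both actions covers randomised policies,
  summing over time telescopes \<open>h\<close>, and the bounded remainder disappears after division
  by \<open>T\<close>.\<close>

lemma average_cost_lower_bound:
  assumes v: "valid_policy pol" and h: "\<And>x. \<bar>h x\<bar> \<le> B * 2 ^ x"
    and le: "\<And>x a. g + h x \<le> cost C lam x a + nxt x a h"
  shows "ereal g \<le> ps_avg_cost C q p lam pol x0"
proof -
  have w: "0 \<le> pol t x" "pol t x \<le> 1" for t x using v by (auto simp: valid_policy_def)
  define D where "D = \<bar>h x0\<bar> + B * (2 ^ x0 + 2 / (1 - rate))"
  have step: "g + mean pol x0 t h \<le> ps_exp_cost C q p lam pol x0 t + mean pol x0 (Suc t) h" for t
  proof -
    have "mean pol x0 t (\<lambda>x. g + h x) \<le> mean pol x0 t (\<lambda>x.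
        (pol t x * cost C lam x True + (1 - pol t x) * cost C lam x False) +
        (pol t x * nxt x True h + (1 - pol t x) * nxt x False h))"
    proof (rule mean_mono)
      fix x
      have "pol t x * (g + h x) + (1 - pol t x) * (g + h x) \<le>
          pol t x * (cost C lam x True + nxt x True h) + (1 - pol t x) * (cost C lam x False + nxt x False h)"
        using w[of t x] le[of x True] le[of x False]
        by (intro add_mono[of "pol t x * (g + h x)"] mult_left_mono) auto
      then show "g + h x \<le> (pol t x * cost C lam x True + (1 - pol t x) * cost C lam x False) +
        (pol t x * nxt x True h + (1 - pol t x) * nxt x False h)"
        by (simp add: algebra_simps)
    qed
    then show ?thesis by (simp add: mean_add ps_exp_cost_eq mean_Suc[OF v])
  qed
  have sum: "g * real T + h x0 - mean pol x0 T h \<le> (\<Sum>t<T. ps_exp_cost C q p lam pol x0 t)" for T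
  proof (induction T)
    case (Suc T)
    then show ?case using step[of T] by (simp add: algebra_simps)
  qed simp
  have lower: "g * real T - D \<le> (\<Sum>t<T. ps_exp_cost C q p lam pol x0 t)" for T
    using sum[of T] mean_abs_le[OF v h, of x0 T] unfolding D_def by linarith
  have lim: "(\<lambda>T. (g * real T - D) / real T) \<longlonglongrightarrow> g"
    by (rule bounded_deviation_average_tendsto[of _ _ "\<bar>D\<bar>"]) simp
  then have "(\<lambda>T. ereal ((g * real T - D) / real T)) \<longlonglongrightarrow> ereal g" by simp
  then have "ereal g = limsup (\<lambda>T. ereal ((g * real T - D) / real T))"
    by (rule lim_imp_Limsup[OF sequentially_bot, symmetric])
  also have "\<dots> \<le> ps_avg_cost C q p lam pol x0"
    unfolding ps_avg_cost_def using lower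
    by (intro Limsup_mono always_eventually allI) (simp add: divide_right_mono)
  finally show ?thesis .
qed

definition time_avg :: "(nat \<Rightarrow> bool) \<Rightarrow> nat \<Rightarrow> (nat \<Rightarrow> real) \<Rightarrow> nat \<Rightarrow> real" where
  "time_avg \<sigma> x0 f T = (\<Sum>t<T. mean (stat_policy \<sigma>) x0 t f) / real T"

text \<open>With equality the same telescoping gives a genuine limit, the same for every
  start.\<close>

lemma poisson_time_avg_tendsto:
  assumes h: "\<And>x. \<bar>h x\<bar> \<le> B * 2 ^ x" and eq: "\<And>x. g + h x = f x + nxt x (\<sigma> x) h"
  shows "time_avg \<sigma> x0 f \<longlonglongrightarrow> g"
proof -
  have step: "mean (stat_policy \<sigma>) x0 t f =
      g + mean (stat_policy \<sigma>) x0 t h - mean (stat_policy \<sigma>) x0 (Suc t) h" for t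
  proof -
    have "f = (\<lambda>x. (g + h x) - nxt x (\<sigma> x) h)" using eq by (auto simp: fun_eq_iff)
    then have "mean (stat_policy \<sigma>) x0 t f = mean (stat_policy \<sigma>) x0 t (\<lambda>x. (g + h x) - nxt x (\<sigma> x) h)"
      by simp
    then show ?thesis by (simp add: mean_add mean_diff mean_stat_Suc)
  qed
  have sum: "(\<Sum>t<T. mean (stat_policy \<sigma>) x0 t f) = g * real T + h x0 - mean (stat_policy \<sigma>) x0 T h" for T
  proof (induction T)
    case (Suc T)
    then show ?case using step[of T] by (simp add: algebra_simps)
  qed simp
  have "\<bar>(\<Sum>t<T. mean (stat_policy \<sigma>) x0 t f) - g * real T\<bar>
      \<le> \<bar>h x0\<bar> + B * (2 ^ x0 + 2 / (1 - rate))" for T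
    using mean_abs_le[OF valid_stat_policy h, of \<sigma> x0 T] unfolding sum by linarith
  then show ?thesis
    unfolding time_avg_def[abs_def] by (rule bounded_deviation_average_tendsto)
qed

section \<open>Long-run averages of functions dominated by a multiple of
  \<open>2 ^ x\<close>\<close>

definition exp_growth :: "(nat \<Rightarrow> real) \<Rightarrow> bool" where
  "exp_growth f \<longleftrightarrow> (\<exists>K. \<forall>x. \<bar>f x\<bar> \<le> K * 2 ^ x)"

lemma exp_growthI: "(\<And>x. \<bar>f x\<bar> \<le> K * 2 ^ x) \<Longrightarrow> exp_growth f"
  by (auto simp: exp_growth_def)

lemma exp_growth_bounded: "(\<And>x. \<bar>f x\<bar> \<le> K) \<Longrightarrow> exp_growth f"
proof (rule exp_growthI)
  fix x assume b: "\<And>x. \<bar>f x\<bar> \<le> K"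
  then have "0 \<le> K" using abs_ge_zero order_trans by blast
  then show "\<bar>f x\<bar> \<le> K * 2 ^ x"
    using b[of x] mult_left_mono[of 1 "2 ^ x" K] by simp
qed

lemma exp_growth_real: "exp_growth real"
  using real_le_power2 by (intro exp_growthI[of _ 1]) simp

text \<open>For functions of exponential growth the limit exists and does not depend on the start,
  by \<open>time_avg_tendsto_avg\<close>. The start 0 suits the comparison of policies up to their
  first passive state.\<close>

definition avg :: "(nat \<Rightarrow> bool) \<Rightarrow> (nat \<Rightarrow> real) \<Rightarrow> real" where
  "avg \<sigma> f = lim (time_avg \<sigma> 0 f)"

text \<open>The average cost equation with singleton action sets is the Poisson equation of
  \<open>\<sigma>\<close>.\<close>

lemma time_avg_tendsto_avg:
  assumes "exp_growth f"
  shows "time_avg \<sigma> x0 f \<longlonglongrightarrow> avg \<sigma> f"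
proof -
  obtain K where K: "\<And>x. \<bar>f x\<bar> \<le> K * 2 ^ x" using assms by (auto simp: exp_growth_def)
  obtain g h B where h: "\<And>x. \<bar>h x\<bar> \<le> B * 2 ^ x"
    and eq: "\<And>x. g + h x = Min ((\<lambda>a. f x + nxt x a h) ` {\<sigma> x})"
    by (rule average_cost_equation[of "\<lambda>x a. f x" K "\<lambda>x. {\<sigma> x}"]) (use K in auto)
  have lim: "time_avg \<sigma> x0 f \<longlonglongrightarrow> g" for x0
    using h eq by (intro poisson_time_avg_tendsto[of h B]) simp_all
  from limI[OF lim[of 0]] lim[of x0] show ?thesis by (simp add: avg_def)
qed

lemma avg_eqI: "time_avg \<sigma> 0 f \<longlonglongrightarrow> l \<Longrightarrow> avg \<sigma> f = l"
  unfolding avg_def by (rule limI)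

lemma avg_linear:
  assumes "exp_growth f" "exp_growth g"
  shows "avg \<sigma> (\<lambda>x. a * f x + b * g x) = a * avg \<sigma> f + b * avg \<sigma> g"
    and "time_avg \<sigma> x0 (\<lambda>x. a * f x + b * g x) \<longlonglongrightarrow> a * avg \<sigma> f + b * avg \<sigma> g"
proof -
  have lim: "time_avg \<sigma> x0 (\<lambda>x. a * f x + b * g x) \<longlonglongrightarrow> a * avg \<sigma> f + b * avg \<sigma> g" for x0
  proof -
    have "time_avg \<sigma> x0 (\<lambda>x. a * f x + b * g x) = (\<lambda>T. a * time_avg \<sigma> x0 f T + b * time_avg \<sigma> x0 g T)"
      by (auto simp: time_avg_def mean_add mean_cmult sum.distrib sum_distrib_left add_divide_distrib)
    then show ?thesis using assms by (auto intro!: tendsto_intros time_avg_tendsto_avg)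
  qed
  show "time_avg \<sigma> x0 (\<lambda>x. a * f x + b * g x) \<longlonglongrightarrow> a * avg \<sigma> f + b * avg \<sigma> g" by (rule lim)
  show "avg \<sigma> (\<lambda>x. a * f x + b * g x) = a * avg \<sigma> f + b * avg \<sigma> g" by (rule avg_eqI[OF lim])
qed

lemma avg_const: "avg \<sigma> (\<lambda>x. c) = c"
proof (rule avg_eqI)
  have "\<forall>\<^sub>F T in sequentially. time_avg \<sigma> 0 (\<lambda>x. c) T = c"
    using eventually_gt_at_top[of 0] by eventually_elim (simp add: time_avg_def)
  then show "time_avg \<sigma> 0 (\<lambda>x. c) \<longlonglongrightarrow> c" by (rule tendsto_eventually)
qed

lemma avg_mono:
  assumes "exp_growth f" "exp_growth g" "\<And>x. f x \<le> g x"
  shows "avg \<sigma> f \<le> avg \<sigma> g"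
proof (rule LIMSEQ_le[OF time_avg_tendsto_avg[OF assms(1), of \<sigma> 0] time_avg_tendsto_avg[OF assms(2), of \<sigma> 0]])
  show "\<exists>N. \<forall>n\<ge>N. time_avg \<sigma> 0 f n \<le> time_avg \<sigma> 0 g n"
    using assms(3) by (auto simp: time_avg_def intro!: divide_right_mono sum_mono mean_mono)
qed

text \<open>Increments telescope and the expectations of \<open>f\<close> stay bounded. The identity
  as \<open>f\<close> yields the balance equation; a bounded test function yields positivity of the
  passive fraction.\<close>

lemma avg_drift:
  assumes "exp_growth f"
  shows "avg \<sigma> (\<lambda>x. nxt x (\<sigma> x) f - f x) = 0"
proof (rule avg_eqI)
  obtain K where K: "\<And>x. \<bar>f x\<bar> \<le> K * 2 ^ x" using assms by (auto simp: exp_growth_def)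
  have sum: "(\<Sum>t<T. mean (stat_policy \<sigma>) 0 t (\<lambda>x. nxt x (\<sigma> x) f - f x)) = mean (stat_policy \<sigma>) 0 T f - f 0" for T
    by (induction T) (simp_all add: mean_diff mean_stat_Suc)
  have "\<bar>(\<Sum>t<T. mean (stat_policy \<sigma>) 0 t (\<lambda>x. nxt x (\<sigma> x) f - f x)) - 0 * real T\<bar>
      \<le> K * (2 ^ 0 + 2 / (1 - rate)) + \<bar>f 0\<bar>" for T
    using mean_abs_le[OF valid_stat_policy K, of \<sigma> 0 T] unfolding sum by linarith
  then show "time_avg \<sigma> 0 (\<lambda>x. nxt x (\<sigma> x) f - f x) \<longlonglongrightarrow> 0"
    unfolding time_avg_def[abs_def] by (rule bounded_deviation_average_tendsto)
qed

definition passive_rate :: "(nat \<Rightarrow> bool) \<Rightarrow> real" where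
  "passive_rate \<sigma> = avg \<sigma> (\<lambda>x. of_bool (\<not> \<sigma> x))"

lemma exp_growth_of_bool: "exp_growth (\<lambda>x. of_bool (P x))"
  by (rule exp_growth_bounded[of _ 1]) simp

lemma ps_avg_cost_time_avg:
  assumes "time_avg \<sigma> x0 (\<lambda>x. cost C lam x (\<sigma> x)) \<longlonglongrightarrow> g"
  shows "ps_avg_cost C q p lam (stat_policy \<sigma>) x0 = ereal g"
proof -
  have "(\<lambda>x. C * real x + (1 - stat_policy \<sigma> t x) * lam) = (\<lambda>x. cost C lam x (\<sigma> x))" for t
    by (auto simp: stat_policy_def cost_def)
  then have "ps_exp_cost C q p lam (stat_policy \<sigma>) x0 t = mean (stat_policy \<sigma>) x0 t (\<lambda>x. cost C lam x (\<sigma> x))" for t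
    by (simp add: ps_exp_cost_def mean_def)
  then have "ps_avg_cost C q p lam (stat_policy \<sigma>) x0 =
      limsup (\<lambda>T. ereal (time_avg \<sigma> x0 (\<lambda>x. cost C lam x (\<sigma> x)) T))"
    by (simp add: ps_avg_cost_def time_avg_def)
  also have "\<dots> = ereal g"
    using assms by (intro lim_imp_Limsup) auto
  finally show ?thesis .
qed

lemma ps_avg_cost_stat:
  "ps_avg_cost C q p lam (stat_policy \<sigma>) x0 = ereal (C * avg \<sigma> real + lam * passive_rate \<sigma>)"
proof (rule ps_avg_cost_time_avg)
  have "(\<lambda>x. cost C lam x (\<sigma> x)) = (\<lambda>x. C * real x + lam * of_bool (\<not> \<sigma> x))"
    by (auto simp: cost_def)
  then show "time_avg \<sigma> x0 (\<lambda>x. cost C lam x (\<sigma> x)) \<longlonglongrightarrow> C * avg \<sigma> real + lam * passive_rate \<sigma>"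
    unfolding passive_rate_def
    using avg_linear(2)[OF exp_growth_real exp_growth_of_bool[of "\<lambda>x. \<not> \<sigma> x"], of \<sigma> x0 C lam] by simp
qed

text \<open>A policy choosing minimisers in the optimality equation attains \<open>g\<close> from
  every start, and no valid policy goes below \<open>g\<close>.\<close>

lemma optimal_policy_exists: "\<exists>\<sigma>. ps_optimal C q p lam \<sigma>"
proof -
  obtain g h B where h: "\<And>x. \<bar>h x\<bar> \<le> B * 2 ^ x"
    and eq: "\<And>x. g + h x = Min ((\<lambda>a. cost C lam x a + nxt x a h) ` UNIV)"
    by (rule average_cost_equation[of "cost C lam" _ "\<lambda>x. UNIV", OF cost_abs_le]) auto
  define \<sigma> where "\<sigma> x = (SOME a. g + h x = cost C lam x a + nxt x a h)" for x
  have \<sigma>: "g + h x = cost C lam x (\<sigma> x) + nxt x (\<sigma> x) h" for x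
    unfolding \<sigma>_def
  proof (rule someI_ex)
    obtain a where "Min ((\<lambda>a. cost C lam x a + nxt x a h) ` UNIV) = cost C lam x a + nxt x a h"
      using Min_image_attained[of "UNIV :: bool set" "\<lambda>a. cost C lam x a + nxt x a h"] by auto
    then show "\<exists>a. g + h x = cost C lam x a + nxt x a h" using eq[of x] by auto
  qed
  have le: "g + h x \<le> cost C lam x a + nxt x a h" for x a
    unfolding eq by (rule Min_le) auto
  have "ps_avg_cost C q p lam (stat_policy \<sigma>) x0 = ereal g" for x0
    using \<sigma> by (intro ps_avg_cost_time_avg poisson_time_avg_tendsto[OF h])
  then have "ps_optimal C q p lam \<sigma>"
    using average_cost_lower_bound[OF _ h le] by (simp add: ps_optimal_def)
  then show ?thesis by blast
qed

section \<open>Threshold policies\<close>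

abbreviation threshold :: "nat \<Rightarrow> nat \<Rightarrow> bool" where
  "threshold m \<equiv> (\<lambda>x. x < m)"

text \<open>At most one job arrives per slot, so from the empty queue the first passive state is never
  overshot: the actions above it are irrelevant for the average cost.\<close>

lemma ps_dist_cong_below_passive:
  assumes "\<And>x. x \<le> m \<Longrightarrow> \<sigma> x = \<tau> x" "\<not> \<sigma> m"
  shows "ps_dist q p (stat_policy \<sigma>) 0 t = ps_dist q p (stat_policy \<tau>) 0 t \<and>
         set_pmf (ps_dist q p (stat_policy \<sigma>) 0 t) \<subseteq> {..m}"
proof (induction t)
  case (Suc t)
  have act: "bind_pmf (bernoulli_pmf (stat_policy \<sigma>' s x)) (\<lambda>a. ps_step q p x a) = ps_step q p x (\<sigma>' x)"
    for \<sigma>' s x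
  proof -
    have "bernoulli_pmf (stat_policy \<sigma>' s x) = return_pmf (\<sigma>' x)"
      by (rule pmf_eqI) (auto simp: stat_policy_def split: split_indicator if_splits)
    then show ?thesis by (simp add: bind_return_pmf)
  qed
  have eq: "ps_dist q p (stat_policy \<sigma>) 0 (Suc t) =
      bind_pmf (ps_dist q p (stat_policy \<tau>) 0 t) (\<lambda>x. ps_step q p x (\<tau> x))"
    using Suc assms(1) by (auto simp: act intro!: bind_pmf_cong)
  have "set_pmf (ps_step q p x (\<tau> x)) \<subseteq> {..m}" if "x \<le> m" for x
    using set_step[of x "\<tau> x"] assms that by (cases "x = m") (force split: if_splits)+
  then show ?case using Suc unfolding eq by (auto simp: act) blast
qed simp

lemma avg_cong_below_passive:
  assumes "\<And>x. x \<le> m \<Longrightarrow> \<sigma> x = \<tau> x" "\<not> \<sigma> m" "\<And>x. x \<le> m \<Longrightarrow> f x = g x"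
  shows "avg \<sigma> f = avg \<tau> g"
proof -
  have "mean (stat_policy \<sigma>) 0 t f = mean (stat_policy \<tau>) 0 t g" for t
  proof -
    note D = ps_dist_cong_below_passive[where \<sigma> = \<sigma> and \<tau> = \<tau> and m = m and t = t, OF assms(1,2), simplified]
    have "mean (stat_policy \<sigma>) 0 t f = mean (stat_policy \<sigma>) 0 t g"
      unfolding mean_def
      by (rule integral_cong_AE) (use D assms(3) in \<open>auto simp: AE_measure_pmf_iff\<close>)
    then show ?thesis using D by (simp add: mean_def)
  qed
  then show ?thesis by (simp add: avg_def time_avg_def[abs_def])
qed

section \<open>Stochastic monotonicity of threshold kernels\<close>

text \<open>Single out one of the \<open>Suc x\<close> jobs. It stays with probability
  \<open>1 - q / Suc x\<close>, at least \<open>s\<close>, which makes up for an arrival of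
  probability \<open>s\<close> in state \<open>x\<close>; the other \<open>x\<close> jobs leave with
  probability \<open>q / Suc x\<close> instead of the larger \<open>q / x\<close>.\<close>

lemma surv_Suc_ge:
  assumes f: "mono f" and s: "0 \<le> s" "s \<le> 1 - q / real (Suc x)" and x: "x > 0"
  shows "surv x (\<lambda>y. (1 - s) * f y + s * f (Suc y)) \<le> surv (Suc x) f"
proof -
  let ?r = "q / real (Suc x)"
  let ?E = "\<lambda>r f. measure_pmf.expectation (binomial_pmf x r) f"
  let ?F = "\<lambda>y. (1 - s) * f y + s * f (Suc y)"
  have r: "?r \<in> {0..1}" by (rule prob_in) simp
  have rx: "q / real x \<in> {0..1}" by (rule prob_in[OF x])
  have F: "?F y \<le> ?F z" if "y \<le> z" for y z
    using s r that f by (intro add_mono mult_left_mono) (auto simp: mono_def)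
  \<comment> \<open>Negated because \<open>?F (x - d)\<close> decreases in the number
    \<open>d\<close> of departures.\<close>
  have "?E ?r (\<lambda>d. - ?F (x - d)) \<le> ?E (q / real x) (\<lambda>d. - ?F (x - d))"
  proof (rule binomial_expectation_mono_prob)
    show "mono (\<lambda>d. - ?F (x - d))" by (rule monoI, subst neg_le_iff_le, rule F) simp
  qed (use r rx x q_pos in \<open>auto intro!: divide_left_mono\<close>)
  then have "surv x ?F \<le> ?E ?r (\<lambda>d. ?F (x - d))"
    by (simp only: surv_pos[OF x] Bochner_Integration.integral_minus neg_le_iff_le)
  also have "\<dots> \<le> ?E ?r (\<lambda>d. ?r * f (Suc x - Suc d) + (1 - ?r) * f (Suc x - d))"
  proof (rule expectation_mono_pmf_finite)
    fix d assume "d \<in> set_pmf (binomial_pmf x ?r)"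
    then have d: "d \<le> x" using r by (auto simp: set_pmf_binomial_eq split: if_splits)
    have "0 \<le> (1 - ?r - s) * (f (Suc (x - d)) - f (x - d))"
      using s f by (intro mult_nonneg_nonneg) (auto simp: mono_def)
    then show "?F (x - d) \<le> ?r * f (Suc x - Suc d) + (1 - ?r) * f (Suc x - d)"
      using d by (simp add: Suc_diff_le algebra_simps del: of_nat_Suc)
  qed (use r in auto)
  also have "\<dots> = surv (Suc x) f"
    using r by (simp add: surv_pos binomial_expectation_Suc del: of_nat_Suc)
  finally show ?thesis .
qed

lemma surv_Suc_ge_same:
  assumes "mono f"
  shows "surv x f \<le> surv (Suc x) f"
proof (cases "x = 0")
  case True
  have "surv (Suc x) (\<lambda>y. f 0) \<le> surv (Suc x) f"
    using assms by (intro surv_mono) (auto simp: mono_def)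
  then show ?thesis using True by (simp add: surv_def)
next
  case False
  then show ?thesis using surv_Suc_ge[OF assms, of 0 x] prob_in[of "Suc x"] by simp
qed

lemma nxt_active_ge: "mono f \<Longrightarrow> nxt x False f \<le> nxt x True f"
  unfolding nxt_conv_surv using p_pos
  by (auto intro!: surv_mono simp: algebra_simps mono_def)

text \<open>Switching from active to passive between \<open>m - 1\<close> and \<open>m\<close> preserves the stochastic order
  because the extra job leaves with probability \<open>q / m \<le> 1/2 < 1 - p\<close>. This can fail for \<open>m = 1\<close>.\<close>

lemma threshold_kernel_mono:
  assumes m: "m \<ge> 2" and f: "mono f"
  shows "mono (\<lambda>x. nxt x (threshold m x) f)"
  unfolding mono_iff_le_Suc
proof
  fix x
  let ?F = "\<lambda>y. (1 - p) * f y + p * f (Suc y)"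
  have F: "mono ?F"
    using f p_pos p_half by (auto simp: mono_def intro!: add_mono mult_left_mono)
  consider "Suc x < m" | "Suc x = m" | "m \<le> x" by linarith
  then show "nxt x (threshold m x) f \<le> nxt (Suc x) (threshold m (Suc x)) f"
  proof cases
    case 1
    then show ?thesis using surv_Suc_ge_same[OF F, of x] by (simp add: nxt_conv_surv)
  next
    case 2
    have "q / real (Suc x) \<le> q / 2"
      using q_pos m 2 by (intro divide_left_mono) auto
    then have "p \<le> 1 - q / real (Suc x)" using q_lt p_half by linarith
    moreover have "x > 0" using m 2 by simp
    ultimately have "surv x ?F \<le> surv (Suc x) f" using surv_Suc_ge[OF f] p_pos by simp
    then show ?thesis using 2 by (auto simp add: nxt_conv_surv)
  next
    case 3
    then show ?thesis using surv_Suc_ge_same[OF f, of x] by (simp add: nxt_conv_surv)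
  qed
qed

text \<open>Only the threshold kernel has to be monotone: the induction hypothesis is applied to its
  image of \<open>f\<close>, and then the kernels are compared pointwise. They differ only at states
  \<open>x \<ge> m\<close> where \<open>\<sigma>\<close> is active.\<close>

lemma threshold_mean_le:
  assumes m: "m \<ge> 2" and \<sigma>: "\<And>x. x < m \<Longrightarrow> \<sigma> x" and f: "mono f"
  shows "mean (stat_policy (threshold m)) x0 t f \<le> mean (stat_policy \<sigma>) x0 t f"
  using f
proof (induction t arbitrary: f)
  case (Suc t)
  have "mean (stat_policy (threshold m)) x0 (Suc t) f
      \<le> mean (stat_policy \<sigma>) x0 t (\<lambda>x. nxt x (threshold m x) f)"
    unfolding mean_stat_Suc by (rule Suc.IH[OF threshold_kernel_mono[OF m Suc.prems]])
  also have "\<dots> \<le> mean (stat_policy \<sigma>) x0 t (\<lambda>x. nxt x (\<sigma> x) f)"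
  proof (rule mean_mono)
    fix x show "nxt x (threshold m x) f \<le> nxt x (\<sigma> x) f"
      using \<sigma>[of x] nxt_active_ge[OF Suc.prems, of x] by (cases "\<sigma> x"; cases "x < m") auto
  qed
  finally show ?case by (simp only: mean_stat_Suc)
qed simp

section \<open>The long-run passive fraction\<close>

definition busy_rate :: "(nat \<Rightarrow> bool) \<Rightarrow> real" where
  "busy_rate \<sigma> = avg \<sigma> (\<lambda>x. of_bool (x \<noteq> 0))"

text \<open>The identity has average drift zero, and a nonempty queue loses \<open>q\<close> jobs
  per slot in expectation whatever its length, so departures enter through the busy fraction
  alone.\<close>

lemma rate_balance: "p * passive_rate \<sigma> = p - q * busy_rate \<sigma>"
proof -
  let ?D = "\<lambda>x. nxt x (\<sigma> x) real - real x"
  have D: "exp_growth ?D"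
    using p_pos p_half q_pos q_lt by (intro exp_growth_bounded[of _ 2]) (auto simp: nxt_id)
  have "(\<lambda>x. 1 * ?D x + p * of_bool (\<not> \<sigma> x)) = (\<lambda>x. p * 1 + (- q) * of_bool (x \<noteq> 0))"
    by (auto simp: nxt_id fun_eq_iff)
  moreover have "avg \<sigma> (\<lambda>x. 1 * ?D x + p * of_bool (\<not> \<sigma> x)) = 1 * avg \<sigma> ?D + p * passive_rate \<sigma>"
    unfolding passive_rate_def by (rule avg_linear(1)[OF D exp_growth_of_bool])
  moreover have "avg \<sigma> (\<lambda>x. p * 1 + (- q) * of_bool (x \<noteq> 0)) = p * avg \<sigma> (\<lambda>x. 1) + (- q) * busy_rate \<sigma>"
    unfolding busy_rate_def
    by (rule avg_linear(1)[OF exp_growth_bounded[of _ 1] exp_growth_of_bool]) simp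
  ultimately show ?thesis using avg_drift[OF exp_growth_real, of \<sigma>] by (simp add: avg_const)
qed

lemma passive_rate_threshold_ge:
  assumes \<sigma>: "\<And>x. x < m \<Longrightarrow> \<sigma> x"
  shows "passive_rate \<sigma> \<le> passive_rate (threshold m)"
proof -
  consider "m = 0" | "m = 1" | "m \<ge> 2" by linarith
  then show ?thesis
  proof cases
    case 1
    have "passive_rate \<sigma> \<le> avg \<sigma> (\<lambda>x. 1)"
      unfolding passive_rate_def
      by (rule avg_mono) (auto intro: exp_growth_of_bool exp_growth_bounded[of _ 1])
    moreover have "passive_rate (threshold m) = 1"
      using 1 avg_const[of "threshold m" 1] by (simp add: passive_rate_def)
    ultimately show ?thesis by (simp add: avg_const)
  next
    \<comment> \<open>Passive implies busy for \<open>\<sigma>\<close>, and the two coincide for the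
      threshold; balance then gives a passive fraction of at most, respectively exactly,
      \<open>p / (p + q)\<close>.\<close>
    case 2
    have "x \<noteq> 0" if "\<not> \<sigma> x" for x
      using \<sigma>[of 0] 2 that by (cases x) auto
    then have "passive_rate \<sigma> \<le> busy_rate \<sigma>"
      unfolding passive_rate_def busy_rate_def
      by (intro avg_mono) (auto intro: exp_growth_of_bool)
    then have "q * passive_rate \<sigma> \<le> q * busy_rate \<sigma>" using q_pos by simp
    then have "(p + q) * passive_rate \<sigma> \<le> p" using rate_balance[of \<sigma>] by (simp add: algebra_simps)
    moreover have "passive_rate (threshold m) = busy_rate (threshold m)"
      using 2 by (simp add: passive_rate_def busy_rate_def)
    then have "(p + q) * passive_rate (threshold m) = p"
      using rate_balance[of "threshold m"] by (simp add: algebra_simps)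
    ultimately have "(p + q) * passive_rate \<sigma> \<le> (p + q) * passive_rate (threshold m)" by simp
    then show ?thesis using p_pos q_pos by simp
  next
    case 3
    have mono: "mono (\<lambda>x::nat. of_bool (x \<noteq> 0) :: real)" by (auto simp: mono_def)
    have le: "mean (stat_policy (threshold m)) 0 t (\<lambda>x. of_bool (x \<noteq> 0))
        \<le> mean (stat_policy \<sigma>) 0 t (\<lambda>x. of_bool (x \<noteq> 0))" for t
      by (rule threshold_mean_le[of m \<sigma>, OF 3 \<sigma> mono])
    have "busy_rate (threshold m) \<le> busy_rate \<sigma>"
      unfolding busy_rate_def
    proof (rule LIMSEQ_le[OF time_avg_tendsto_avg[of _ _ 0] time_avg_tendsto_avg[of _ _ 0]])
      show "\<exists>N. \<forall>n\<ge>N. time_avg (threshold m) 0 (\<lambda>x. of_bool (x \<noteq> 0)) n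
          \<le> time_avg \<sigma> 0 (\<lambda>x. of_bool (x \<noteq> 0)) n"
        unfolding time_avg_def using le by (auto intro!: divide_right_mono sum_mono)
    qed (rule exp_growth_of_bool)+
    then have "q * busy_rate (threshold m) \<le> q * busy_rate \<sigma>" using q_pos by simp
    then have "p * passive_rate \<sigma> \<le> p * passive_rate (threshold m)"
      by (simp add: rate_balance)
    then show ?thesis using p_pos by simp
  qed
qed

text \<open>Only the event of no departure is kept; its probability \<open>(1 - q / x) ^ x\<close>
  is at least \<open>1 - q\<close> by Bernoulli's inequality.\<close>

lemma surv_no_departure_le:
  assumes g: "\<And>y. 0 \<le> g y"
  shows "(1 - q) * g x \<le> surv x g"
proof (cases "x = 0")
  case True
  then show ?thesis using g[of 0] q_pos mult_right_mono[of "1 - q" 1 "g 0"] by simp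
next
  case False
  let ?r = "q / real x"
  let ?M = "binomial_pmf x ?r"
  have r: "?r \<in> {0..1}" using False by (intro prob_in) simp
  have "1 - q = 1 + real x * (- ?r)" using False by simp
  also have "\<dots> \<le> (1 + (- ?r)) ^ x" using r by (intro Bernoulli_inequality) auto
  finally have "(1 - q) * g x \<le> (1 - ?r) ^ x * g x" using g[of x] by (intro mult_right_mono) auto
  also have "\<dots> = measure_pmf.expectation ?M (\<lambda>d. 0 ^ d * g x)"
    using binomial_expectation_power[OF r, of x 0] by simp
  also have "\<dots> \<le> measure_pmf.expectation ?M (\<lambda>d. g (x - d))"
    by (rule expectation_mono_pmf_finite) (use r g in \<open>auto simp: power_0_left\<close>)
  finally show ?thesis using False by (simp add: surv_pos)
qed

text \<open>A bounded function that gains at least 1 in expectation from every active state must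
  lose it again in passive ones, since its average drift is zero; these therefore have positive
  frequency.\<close>

lemma passive_rate_threshold_pos: "0 < passive_rate (threshold m)"
proof -
  \<comment> \<open>\<open>u\<close> is a lower bound for the probability of an arrival without
    departure. With \<open>u * K = 2\<close> this event alone contributes \<open>2 * f x\<close> to
    the expectation below \<open>m\<close>, and \<open>f x \<ge> 1\<close> turns this into a gain of
    1.\<close>
  define u where "u = p * (1 - q)"
  define K where "K = 2 / u"
  have u: "0 < u" "u < 1"
    using p_pos p_half q_pos q_lt mult_strict_mono[of p 1 "1 - q" 1] by (auto simp: u_def)
  have K: "1 \<le> K" "u * K = 2" using u by (auto simp: K_def)
  define f where "f y = K ^ min y m" for y
  have f: "1 \<le> f y" "f y \<le> K ^ m" for y
    using K(1) by (auto simp: f_def intro: one_le_power power_increasing)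
  have growth: "exp_growth f"
    using f by (intro exp_growth_bounded[of _ "K ^ m"]) (simp add: abs_of_nonneg order_trans[OF zero_le_one])
  let ?D = "\<lambda>x. nxt x (threshold m x) f - f x"
  have nf: "0 \<le> nxt x a f" "nxt x a f \<le> K ^ m" for x a
    using nxt_mono[of "\<lambda>_. 0" f x a] nxt_mono[of f "\<lambda>_. K ^ m" x a] f order_trans[OF zero_le_one]
    by auto
  have D_growth: "exp_growth ?D"
  proof (rule exp_growth_bounded)
    fix x show "\<bar>?D x\<bar> \<le> K ^ m"
      using nf[of x "x < m"] f[of x] by linarith
  qed
  have up: "1 + f x \<le> nxt x True f" if "x < m" for x
  proof -
    have f0: "0 \<le> f y" for y using f(1)[of y] by linarith
    have "1 + f x \<le> 2 * f x" using f(1)[of x] by simp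
    also have "\<dots> = (1 - q) * (p * f (Suc x))"
      using that K(2) by (simp add: f_def u_def mult_ac flip: K(2))
    also have "\<dots> \<le> (1 - q) * ((1 - p) * f x + p * f (Suc x))"
      using q_lt p_half f0[of x] by (intro mult_left_mono) auto
    also have "\<dots> \<le> nxt x True f"
      unfolding nxt_conv_surv
      using surv_no_departure_le[of "\<lambda>y. (1 - p) * f y + p * f (Suc y)" x] f0 p_pos p_half
      by simp
    finally show ?thesis .
  qed
  have "1 = avg (threshold m) (\<lambda>x. 1)" by (simp add: avg_const)
  \<comment> \<open>In passive states the drift is at least \<open>- K ^ m\<close>; the weight
    \<open>1 + K ^ m\<close> lifts it to 1.\<close>
  also have "\<dots> \<le> avg (threshold m) (\<lambda>x. 1 * ?D x + (1 + K ^ m) * of_bool (\<not> threshold m x))"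
  proof (rule avg_mono)
    have b: "1 \<le> 1 * ?D x + (1 + K ^ m) * of_bool (\<not> threshold m x)" for x
      using up[of x] nf(1)[of x "x < m"] f(2)[of x] by (cases "x < m") auto
    then show "1 \<le> 1 * ?D x + (1 + K ^ m) * of_bool (\<not> threshold m x)" for x .
    show "exp_growth (\<lambda>x. 1 * ?D x + (1 + K ^ m) * of_bool (\<not> threshold m x))"
    proof (rule exp_growth_bounded)
      fix x
      show "\<bar>1 * ?D x + (1 + K ^ m) * of_bool (\<not> threshold m x)\<bar> \<le> 1 + 2 * K ^ m"
        using b[of x] nf(2)[of x "x < m"] f[of x] by (cases "x < m") auto
    qed
  qed (rule exp_growth_bounded[of _ 1], simp)
  also have "\<dots> = 1 * avg (threshold m) ?D + (1 + K ^ m) * passive_rate (threshold m)"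
    unfolding passive_rate_def by (rule avg_linear(1)[OF D_growth exp_growth_of_bool])
  also have "\<dots> = (1 + K ^ m) * passive_rate (threshold m)"
    using avg_drift[OF growth, of "threshold m"] by simp
  finally have "0 < (1 + K ^ m) * passive_rate (threshold m)" by simp
  moreover have "0 < 1 + K ^ m" using f(2)[of 0] f(1)[of 0] by linarith
  ultimately show ?thesis by (simp add: zero_less_mult_iff)
qed

section \<open>Passive sets\<close>

definition objective :: "real \<Rightarrow> real \<Rightarrow> (nat \<Rightarrow> bool) \<Rightarrow> real" where
  "objective C lam \<sigma> = C * avg \<sigma> real + lam * passive_rate \<sigma>"

lemma ps_optimal_objective_le: "ps_optimal C q p lam \<sigma> \<Longrightarrow> objective C lam \<sigma> \<le> objective C lam \<tau>"
  by (auto simp: ps_optimal_def objective_def ps_avg_cost_stat dest!: spec[of _ "stat_policy \<tau>"])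

lemma ps_optimal_of_objective_le:
  assumes "ps_optimal C q p lam \<sigma>" "objective C lam \<tau> \<le> objective C lam \<sigma>"
  shows "ps_optimal C q p lam \<tau>"
  unfolding ps_optimal_def
proof (intro allI impI)
  fix x0 pol assume "valid_policy pol"
  then have "ereal (objective C lam \<sigma>) \<le> ps_avg_cost C q p lam pol x0"
    using assms(1) by (simp add: ps_optimal_def ps_avg_cost_stat objective_def)
  then show "ps_avg_cost C q p lam (stat_policy \<tau>) x0 \<le> ps_avg_cost C q p lam pol x0"
    using assms(2) unfolding ps_avg_cost_stat objective_def[symmetric]
    by (meson ereal_less_eq(3) order_trans)
qed

text \<open>Cut \<open>\<sigma>\<close> off at its least passive state. The objective is computed
  from the start 0, where nothing above that state is seen, yet it is the average cost from every
  start.\<close>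

lemma passive_state_optimal_threshold:
  assumes "ps_optimal C q p lam \<sigma>" "\<not> \<sigma> x"
  shows "\<exists>m\<le>x. ps_optimal C q p lam (threshold m)"
proof -
  define m where "m = (LEAST x. \<not> \<sigma> x)"
  have m: "\<not> \<sigma> m" "m \<le> x" unfolding m_def using assms(2) by (rule LeastI, rule Least_le)
  have below: "\<sigma> y = threshold m y" if "y \<le> m" for y
    using m(1) not_less_Least[of y "\<lambda>x. \<not> \<sigma> x"] that unfolding m_def[symmetric]
    by (cases "y = m") auto
  have "objective C lam \<sigma> = objective C lam (threshold m)"
    using avg_cong_below_passive[of m \<sigma> "threshold m" real real] below m(1)
      avg_cong_below_passive[of m \<sigma> "threshold m" "\<lambda>x. of_bool (\<not> \<sigma> x)"
        "\<lambda>x. of_bool (\<not> threshold m x)"]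
    by (simp add: objective_def passive_rate_def)
  then show ?thesis using ps_optimal_of_objective_le[OF assms(1), of "threshold m"] m(2) by auto
qed

lemma passive_set_eq: "passive_set C q p lam = {x. \<exists>m\<le>x. ps_optimal C q p lam (threshold m)}"
proof (intro set_eqI iffI)
  fix x assume "x \<in> passive_set C q p lam"
  then show "x \<in> {x. \<exists>m\<le>x. ps_optimal C q p lam (threshold m)}"
    using passive_state_optimal_threshold by (auto simp: passive_set_def)
next
  fix x assume "x \<in> {x. \<exists>m\<le>x. ps_optimal C q p lam (threshold m)}"
  then obtain m where "m \<le> x" "ps_optimal C q p lam (threshold m)" by auto
  then show "x \<in> passive_set C q p lam"
    unfolding passive_set_def by (intro CollectI exI[of _ "threshold m"]) simp
qed

lemma passive_set_antimono:
  assumes "lam1 \<le> lam2"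
  shows "passive_set C q p lam2 \<subseteq> passive_set C q p lam1"
proof
  fix x assume "x \<in> passive_set C q p lam2"
  then obtain m where m: "m \<le> x" "ps_optimal C q p lam2 (threshold m)"
    by (auto simp: passive_set_eq)
  obtain \<tau> where \<tau>: "ps_optimal C q p lam1 \<tau>" using optimal_policy_exists by blast
  show "x \<in> passive_set C q p lam1"
  proof (cases "\<exists>n\<le>m. \<not> \<tau> n")
    case True
    then obtain n k where "n \<le> m" "k \<le> n" "ps_optimal C q p lam1 (threshold k)"
      using passive_state_optimal_threshold[OF \<tau>] by blast
    then show ?thesis using m(1) by (auto simp: passive_set_eq intro!: exI[of _ k])
  next
    \<comment> \<open>Here \<open>\<tau>\<close> is active up to \<open>m\<close>, so its passive
      fraction is at most that of the threshold. Lowering the tax thus favours the threshold at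
      least as much, and it stays no worse than \<open>\<tau>\<close>.\<close>
    case False
    then have "passive_rate \<tau> \<le> passive_rate (threshold m)"
      by (intro passive_rate_threshold_ge) auto
    then have "(lam2 - lam1) * passive_rate \<tau> \<le> (lam2 - lam1) * passive_rate (threshold m)"
      using assms by (intro mult_left_mono) auto
    then have "objective C lam1 (threshold m) \<le> objective C lam1 \<tau>"
      using ps_optimal_objective_le[OF m(2), of \<tau>] by (simp add: objective_def algebra_simps)
    then have "ps_optimal C q p lam1 (threshold m)" by (rule ps_optimal_of_objective_le[OF \<tau>])
    then show ?thesis using m(1) by (auto simp: passive_set_eq)
  qed
qed

lemma avg_real_nonneg: "0 \<le> avg \<sigma> real"
  using avg_mono[OF exp_growth_bounded[of "\<lambda>_. 0" 0] exp_growth_real, of \<sigma>] by (simp add: avg_const)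

text \<open>Without a tax, an always passive queue started empty costs nothing, and no policy can
  cost less.\<close>

lemma passive_set_zero:
  assumes "C > 0"
  shows "passive_set C q p 0 = UNIV"
proof -
  obtain \<tau> where \<tau>: "ps_optimal C q p 0 \<tau>" using optimal_policy_exists by blast
  have "avg (threshold 0) real = avg (threshold 0) (\<lambda>x. 0)"
    by (rule avg_cong_below_passive[of 0]) auto
  then have "objective C 0 (threshold 0) \<le> objective C 0 \<tau>"
    using avg_real_nonneg[of \<tau>] assms by (simp add: objective_def avg_const)
  then have "ps_optimal C q p 0 (threshold 0)" by (rule ps_optimal_of_objective_le[OF \<tau>])
  then show ?thesis by (auto simp: passive_set_eq)
qed

text \<open>The tax \<open>(A + 1) / \<delta>\<close> charges every threshold
  \<open>m \<le> x\<close> at least \<open>A + 1\<close> for passivity, while never being passive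
  costs \<open>A\<close> in total.\<close>

lemma not_passive_for_large_tax:
  assumes "C > 0"
  shows "\<exists>lam. x \<notin> passive_set C q p lam"
proof -
  define \<delta> where "\<delta> = passive_rate (threshold x)"
  define A where "A = C * avg (\<lambda>_. True) real"
  have \<delta>: "0 < \<delta>" unfolding \<delta>_def by (rule passive_rate_threshold_pos)
  have A: "0 \<le> A" using assms avg_real_nonneg by (simp add: A_def)
  have never: "passive_rate (\<lambda>_. True) = 0" by (simp add: passive_rate_def avg_const)
  have "\<not> ps_optimal C q p ((A + 1) / \<delta>) (threshold m)" if "m \<le> x" for m
  proof
    assume "ps_optimal C q p ((A + 1) / \<delta>) (threshold m)"
    from ps_optimal_objective_le[OF this, of "\<lambda>_. True"]
    have "C * avg (threshold m) real + (A + 1) / \<delta> * passive_rate (threshold m) \<le> A"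
      by (simp add: objective_def A_def never)
    moreover have "0 \<le> C * avg (threshold m) real" using assms avg_real_nonneg by simp
    moreover have "(A + 1) / \<delta> * \<delta> \<le> (A + 1) / \<delta> * passive_rate (threshold m)"
      using that A \<delta> passive_rate_threshold_ge[of m "threshold x"]
      by (intro mult_left_mono) (auto simp: \<delta>_def)
    ultimately show False using \<delta> by simp
  qed
  then show ?thesis by (auto simp: passive_set_eq)
qed

text \<open>In \<open>enat\<close> the infimum of a nonempty set is attained and that of the empty
  set is infinite, which encodes an empty passive set; upward closure does the rest.\<close>

lemma passive_set_threshold: "passive_set C q p lam = {x. Inf (enat ` passive_set C q p lam) \<le> enat x}"
proof (intro set_eqI iffI)
  fix x assume "x \<in> passive_set C q p lam"
  then show "x \<in> {x. Inf (enat ` passive_set C q p lam) \<le> enat x}" by (auto intro: Inf_lower)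
next
  fix x assume "x \<in> {x. Inf (enat ` passive_set C q p lam) \<le> enat x}"
  then have le: "Inf (enat ` passive_set C q p lam) \<le> enat x" by simp
  then have "enat ` passive_set C q p lam \<noteq> {}" by (auto simp: Inf_enat_def)
  then have "Inf (enat ` passive_set C q p lam) \<in> enat ` passive_set C q p lam"
    by (auto simp: Inf_enat_def intro: LeastI)
  then obtain y where "y \<in> passive_set C q p lam" "y \<le> x" using le by auto
  then show "x \<in> passive_set C q p lam" by (auto simp: passive_set_eq intro: order_trans)
qed

end

theorem mainTheorem10:
  fixes C q p :: real
  assumes "C > 0" and "0 < p" and "p < 1" and "2 * p < q" and "q < 1"
  shows "(\<exists>thr :: real \<Rightarrow> enat. mono thr \<and>
            (\<forall>lam. passive_set C q p lam = {x. thr lam \<le> enat x}))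
       \<and> (\<forall>lam1 lam2. lam1 \<le> lam2 \<longrightarrow> passive_set C q p lam2 \<subseteq> passive_set C q p lam1)
       \<and> (\<Inter>lam. passive_set C q p lam) = {}
       \<and> (\<Union>lam. passive_set C q p lam) = UNIV"
proof -
  interpret processor_sharing q p using assms by unfold_locales
  have "mono (\<lambda>lam. Inf (enat ` passive_set C q p lam))"
    using passive_set_antimono by (auto simp: mono_def intro!: Inf_superset_mono image_mono)
  then have "\<exists>thr :: real \<Rightarrow> enat. mono thr \<and> (\<forall>lam. passive_set C q p lam = {x. thr lam \<le> enat x})"
    using passive_set_threshold by blast
  moreover have "(\<Inter>lam. passive_set C q p lam) = {}"
    using not_passive_for_large_tax[OF assms(1)] by blast
  moreover have "(\<Union>lam. passive_set C q p lam) = UNIV"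
    using passive_set_zero[OF assms(1)] by blast
  ultimately show ?thesis using passive_set_antimono by blast
qed

end
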